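(* Consider an instance of the PRTRP with $n$ fault locations, and let $U$ be an upper bound for the optimal objective value of the PRTRP. Given a vertex $i\in V_c$ and some position $k\in\{1,\dots,n\}$ with $k>n-|S_i|$, let $$L_i^k=\sum_{\substack{1\le p\le n:\\ p\le n-|S_i|\ \text{or}\ p\ge k+1}}(n-p+1)\,s_p+|S_i|\sum_{p=n-|S_i|+1}^{k}s_p.$$ If $L_i^k>U$, then any optimal Hamiltonian cycle for the PRTRP will not visit vertex $i$ at the $k$-th position or later.
   Context: Instance of the Power Restoration Traveling Repairman Problem (PRTRP): Let $n\ge 1$, let $V_c=\{1,2,\dots,n\}$ be the set of fault locations (customers), let vertex $0$ be the depot, and let $V=V_c\cup\{0\}$. The road network is a complete directed graph $G=(V,A)$, where each arc $(i,j)\in A$ ($i\neq j$) represents a shortest path from location $i$ to location $j$ and has travel time (length) $d_{ij}\ge 0$. The power network is a directed tree $T=(V_c,A_c)$ rooted at vertex $1$ (the unique power source, with all arcs directed away from it). Write $i\succeq j$ if $i=j$ or $j$ is reachable from $i$ by a directed path in $T$. Repair durations are zero. Solutions and objective: A solution is a Hamiltonian cycle $H=(j_0=0,j_1,\dots,j_n,0)$ in $G$ starting at the depot; $H$ visits vertex $i$ at the $k$-th position if $j_k=i$. The crew leaves the depot at time $0$ and arrives at $j_p$ at time $t_{j_p}=\sum_{q=1}^{p}d_{j_{q-1}j_q}$, repairing the fault there instantaneously. The service disruption time of $j\in V_c$ is $r_j=\max\{t_i : i\succeq j\}$. The objective value of $H$ is its total service disruption time $\sum_{j\in V_c}r_j$,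 and $H$ is optimal if it minimizes this quantity over all Hamiltonian cycles; the minimum is the optimal objective value. Notation: $S_i=\{j\in V_c : i\succeq j\}$ is the set of successors of $i$ in the power network, including $i$, and $|S_i|$ is its cardinality. $s_p$ is the length of the $p$-th shortest arc in the road network $G$ (arc lengths sorted in non-decreasing order, with multiplicity). *)

theory Defs
  imports
    Complex_Main
    "HOL-Library.Multiset"
    "Graph_Theory.Pair_Digraph"
    "Graph_Theory.Vertex_Walk"
begin

text \<open>
  Out-tree (arborescence): every vertex is the end of exactly one directed walk from the root.
  Quantifying over walks rather than paths excludes loops and directed cycles as well.
\<close>
locale rooted_directed_tree = wf_digraph G for G :: "('a, 'b) pre_digraph" +
  fixes root :: 'a
  assumes root_in_verts: "root \<in> verts G"
    and unique_awalk: "v \<in> verts G \<Longrightarrow> \<exists>!p. awalk root p v"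

text \<open>
  An instance is given by the number n of customers, the arc lengths d of the road network on
  the vertices 0, ..., n (with depot 0; values of d off the arcs are irrelevant), and the power
  network T on the customers 1, ..., n.
\<close>

definition road_network :: "nat \<Rightarrow> nat pair_pre_digraph" where
  "road_network n = \<lparr> pverts = {0..n}, parcs = {(i, j). i \<in> {0..n} \<and> j \<in> {0..n} \<and> i \<noteq> j} \<rparr>"

definition prtrp_instance :: "nat \<Rightarrow> (nat \<Rightarrow> nat \<Rightarrow> real) \<Rightarrow> nat pair_pre_digraph \<Rightarrow> bool" where
  "prtrp_instance n d T \<longleftrightarrow>
     n \<ge> 1 \<and>
     (\<forall>(i, j) \<in> parcs (road_network n). d i j \<ge> 0) \<and>
     pverts T = {1..n} \<and>
     rooted_directed_tree (with_proj T) 1"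

definition power_successors :: "nat pair_pre_digraph \<Rightarrow> nat \<Rightarrow> nat set" where
  "power_successors T i = {j \<in> pverts T. i \<rightarrow>\<^sup>*\<^bsub>with_proj T\<^esub> j}"

text \<open>
  A Hamiltonian cycle is the list \<open>[0, j\<^sub>1, \<dots>, j\<^sub>n, 0]\<close> of its vertices, with the depot at both
  ends, so that \<open>H ! k\<close> is the vertex at position \<open>k\<close>.
\<close>
definition hamiltonian_cycle :: "nat \<Rightarrow> nat list \<Rightarrow> bool" where
  "hamiltonian_cycle n H \<longleftrightarrow>
     vwalk H (with_proj (road_network n)) \<and> hd H = 0 \<and> last H = 0 \<and>
     distinct (tl H) \<and> set (tl H) = pverts (road_network n)"

text \<open>The return to the depot at the end of the list does not count as a position.\<close>
definition visits_at :: "nat list \<Rightarrow> nat \<Rightarrow> nat \<Rightarrow> bool" where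
  "visits_at H i k \<longleftrightarrow> k < length H - 1 \<and> H ! k = i"

definition position :: "nat list \<Rightarrow> nat \<Rightarrow> nat" where
  "position H i = (THE k. visits_at H i k)"

definition arrival_time :: "(nat \<Rightarrow> nat \<Rightarrow> real) \<Rightarrow> nat list \<Rightarrow> nat \<Rightarrow> real" where
  "arrival_time d H i = (\<Sum>q = 1..position H i. d (H ! (q - 1)) (H ! q))"

definition disruption_time ::
  "(nat \<Rightarrow> nat \<Rightarrow> real) \<Rightarrow> nat pair_pre_digraph \<Rightarrow> nat list \<Rightarrow> nat \<Rightarrow> real" where
  "disruption_time d T H j =
     Max (arrival_time d H ` {i \<in> pverts T. i \<rightarrow>\<^sup>*\<^bsub>with_proj T\<^esub> j})"

definition total_disruption ::
  "(nat \<Rightarrow> nat \<Rightarrow> real) \<Rightarrow> nat pair_pre_digraph \<Rightarrow> nat list \<Rightarrow> real" where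
  "total_disruption d T H = (\<Sum>j \<in> pverts T. disruption_time d T H j)"

definition optimal_cycle ::
  "nat \<Rightarrow> (nat \<Rightarrow> nat \<Rightarrow> real) \<Rightarrow> nat pair_pre_digraph \<Rightarrow> nat list \<Rightarrow> bool" where
  "optimal_cycle n d T H \<longleftrightarrow> is_arg_min (total_disruption d T) (hamiltonian_cycle n) H"

definition optimal_value ::
  "nat \<Rightarrow> (nat \<Rightarrow> nat \<Rightarrow> real) \<Rightarrow> nat pair_pre_digraph \<Rightarrow> real" where
  "optimal_value n d T = Min (total_disruption d T ` {H. hamiltonian_cycle n H})"

text \<open>The minimum above ranges over a finite nonempty set.\<close>

lemma finite_hamiltonian_cycles: "finite {H. hamiltonian_cycle n H}"
proof (rule finite_subset)
  show "{H. hamiltonian_cycle n H} \<subseteq> {H. set H \<subseteq> {0..n} \<and> length H = n + 2}"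
  proof clarify
    fix H assume H: "hamiltonian_cycle n H"
    then have "length (tl H) = card (set (tl H))"
      unfolding hamiltonian_cycle_def by (metis distinct_card)
    also have "\<dots> = n + 1"
      using H by (simp add: hamiltonian_cycle_def road_network_def)
    finally show "set H \<subseteq> {0..n} \<and> length H = n + 2"
      using H by (auto simp: hamiltonian_cycle_def vwalk_def road_network_def)
  qed
  show "finite {H. set H \<subseteq> {0..n} \<and> length H = n + 2}"
    by (rule finite_lists_length_eq) simp
qed

lemma vwalk_arcs_nth:
  "set (vwalk_arcs p) = {(p ! k, p ! Suc k) | k. Suc k < length p}"
proof (induction p rule: vwalk_arcs.induct)
  case (3 x y xs)
  have "{(( x # y # xs) ! k, (x # y # xs) ! Suc k) | k. Suc k < length (x # y # xs)} =
      insert (x, y) {((y # xs) ! k, (y # xs) ! Suc k) | k. Suc k < length (y # xs)}"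
    (is "?A = insert _ ?B")
  proof
    show "?A \<subseteq> insert (x, y) ?B"
    proof
      fix e assume "e \<in> ?A"
      then obtain k where "e = ((x # y # xs) ! k, (x # y # xs) ! Suc k)"
        "Suc k < length (x # y # xs)" by blast
      then show "e \<in> insert (x, y) ?B" by (cases k) auto
    qed
    show "insert (x, y) ?B \<subseteq> ?A" by force
  qed
  with 3 show ?case by simp
qed auto

lemma ex_hamiltonian_cycle:
  assumes "n \<ge> 1"
  shows "hamiltonian_cycle n ([0..<Suc n] @ [0])"
proof -
  let ?H = "[0..<Suc n] @ [0]"
  have tl: "tl ?H = [1..<Suc n] @ [0]" by (simp add: upt_conv_Cons del: upt_Suc)
  have "set (vwalk_arcs ?H) \<subseteq> parcs (road_network n)"
    using assms by (auto simp: vwalk_arcs_nth road_network_def nth_append simp del: upt_Suc)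
  then have "vwalk ?H (with_proj (road_network n))"
    by (auto simp: vwalk_def road_network_def)
  moreover have "hd ?H = 0" by (simp add: upt_conv_Cons del: upt_Suc)
  ultimately show ?thesis
    unfolding hamiltonian_cycle_def tl by (auto simp: road_network_def)
qed

text \<open>Length of the \<open>p\<close>-th shortest road arc, with multiplicity; positions start at \<open>p = 1\<close>.\<close>
definition shortest_arc_length :: "nat \<Rightarrow> (nat \<Rightarrow> nat \<Rightarrow> real) \<Rightarrow> nat \<Rightarrow> real" where
  "shortest_arc_length n d p =
     sorted_list_of_multiset {# d i j. (i, j) \<in># mset_set (parcs (road_network n)) #} ! (p - 1)"

text \<open>
  The natural-number subtractions below do not truncate: a customer has at most \<open>n\<close> successors.
\<close>
definition position_bound ::
  "nat \<Rightarrow> (nat \<Rightarrow> nat \<Rightarrow> real) \<Rightarrow> nat pair_pre_digraph \<Rightarrow> nat \<Rightarrow> nat \<Rightarrow> real" where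
  "position_bound n d T i k =
     (let m = card (power_successors T i); s = shortest_arc_length n d in
      (\<Sum>p \<in> {p \<in> {1..n}. p \<le> n - m \<or> p \<ge> k + 1}. real (n - p + 1) * s p) +
      real m * (\<Sum>p = n - m + 1..k. s p))"

end

theory Submission
  imports Defs
begin

text \<open>
  Let a cycle traverse legs of lengths \<open>a\<^sub>1, \<dots>, a\<^sub>n\<close> up to its last customer, so that the arrival
  time at position \<open>p\<close> is \<open>a\<^sub>1 + \<dots> + a\<^sub>p\<close>, and suppose that it reaches \<open>i\<close> at position \<open>k\<close> or
  later. A customer is restored no earlier than it is reached itself, and a successor of \<open>i\<close> also
  no earlier than position \<open>k\<close> is reached. Hence the leg \<open>a\<^sub>q\<close> delays all \<open>n - q + 1\<close> customers at
  positions from \<open>q\<close> on, and if \<open>q \<le> k\<close> it delays all \<open>m = |S\<^sub>i|\<close> successors of \<open>i\<close> as well. The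
  larger of the counts that apply, \<open>n - q + 1\<close> for \<open>q \<le> n - m\<close> or \<open>q > k\<close> and \<open>m\<close> in between, is
  exactly the coefficient \<open>w\<^sub>q\<close> of \<open>s\<^sub>q\<close> in \<open>L\<^sub>i\<^sup>k\<close>, so the objective value is at least
  \<open>w\<^sub>1 a\<^sub>1 + \<dots> + w\<^sub>n a\<^sub>n\<close> (\<open>weighted_legs_le_total_disruption\<close>).

  The legs are lengths of distinct road arcs, so any \<open>q\<close> of them are together at least as long as
  the \<open>q\<close> shortest arcs. As \<open>k > n - m\<close>, the weights \<open>w\<^sub>q\<close> never increase, and Abel summation turns
  this comparison of partial sums into \<open>w\<^sub>1 s\<^sub>1 + \<dots> + w\<^sub>n s\<^sub>n \<le> w\<^sub>1 a\<^sub>1 + \<dots> + w\<^sub>n a\<^sub>n\<close>. So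
  every cycle with \<open>i\<close> at position \<open>k\<close> or later has value at least \<open>L\<^sub>i\<^sup>k\<close>, whereas an optimal
  cycle has value at most \<open>U\<close>.
\<close>

section \<open>Weighted sums and smallest elements\<close>

text \<open>
  The induction step is Abel summation: \<open>w\<^sub>n X\<^sub>n\<close> may be lowered to \<open>w\<^sub>n\<^sub>+\<^sub>1 X\<^sub>n\<close> because the
  partial sum \<open>X\<^sub>n\<close> is nonnegative.
\<close>
lemma abel_lower_bound:
  fixes w x :: "nat \<Rightarrow> 'a::linordered_idom"
  assumes "\<And>p. 1 \<le> p \<Longrightarrow> p < n \<Longrightarrow> w (Suc p) \<le> w p"
    and "\<And>q. q \<le> n \<Longrightarrow> 0 \<le> (\<Sum>p = 1..q. x p)"
  shows "w n * (\<Sum>p = 1..n. x p) \<le> (\<Sum>p = 1..n. w p * x p)"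
  using assms
proof (induction n)
  case (Suc n)
  have "w (Suc n) * (\<Sum>p = 1..n. x p) \<le> w n * (\<Sum>p = 1..n. x p)"
  proof (cases "n = 0")
    case False
    then show ?thesis using Suc.prems by (intro mult_right_mono) auto
  qed simp
  also have "\<dots> \<le> (\<Sum>p = 1..n. w p * x p)"
    using Suc.prems by (intro Suc.IH) auto
  finally show ?case by (simp add: distrib_left)
qed simp

lemma weighted_sum_mono_of_partial_sums:
  fixes w s a :: "nat \<Rightarrow> 'a::linordered_idom"
  assumes "\<And>p. 1 \<le> p \<Longrightarrow> p < n \<Longrightarrow> w (Suc p) \<le> w p" and "0 \<le> w n"
    and partial: "\<And>q. q \<le> n \<Longrightarrow> (\<Sum>p = 1..q. s p) \<le> (\<Sum>p = 1..q. a p)"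
  shows "(\<Sum>p = 1..n. w p * s p) \<le> (\<Sum>p = 1..n. w p * a p)"
proof -
  have "0 \<le> w n * (\<Sum>p = 1..n. a p - s p)"
    using assms(2) partial[of n] by (simp add: sum_subtractf)
  also have "\<dots> \<le> (\<Sum>p = 1..n. w p * (a p - s p))"
    using assms(1) partial by (intro abel_lower_bound) (auto simp: sum_subtractf)
  finally show ?thesis by (simp add: right_diff_distrib sum_subtractf)
qed

text \<open>
  Induction on the sorted list: its head \<open>x\<close> is at most any element of \<open>N\<close>, so it can be charged
  to one of them, and the rest of \<open>N\<close> stays in the tail provided that \<open>x\<close> itself is chosen
  whenever it occurs in \<open>N\<close>.
\<close>
lemma sum_list_take_sorted_le_sum_mset:
  fixes xs :: "'a::{linorder, ordered_comm_monoid_add} list"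
  assumes "sorted xs" and "N \<subseteq># mset xs"
  shows "sum_list (take (size N) xs) \<le> sum_mset N"
  using assms
proof (induction xs arbitrary: N)
  case (Cons x xs)
  show ?case
  proof (cases "N = {#}")
    case False
    obtain y where y: "y \<in># N" "N - {#y#} \<subseteq># mset xs"
    proof (cases "x \<in># N")
      case True
      then show ?thesis using Cons.prems that[of x] by (simp add: subset_eq_diff_conv)
    next
      case notin: False
      obtain y where "y \<in># N" using False by blast
      moreover have "N \<subseteq># mset xs"
      proof (rule mset_subset_eqI)
        fix z
        show "count N z \<le> count (mset xs) z"
          using mset_subset_eq_count[OF Cons.prems(2), of z] notin
          by (cases "z = x") (auto simp: not_in_iff)
      qed
      ultimately show ?thesis using that by (meson diff_subset_eq_self subset_mset.order_trans)
    qed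
    define N' where "N' = N - {#y#}"
    have N: "N = add_mset y N'" using y(1) by (simp add: N'_def)
    have "x \<le> y" using Cons.prems y(1) by (auto dest!: mset_subset_eqD)
    moreover have "sum_list (take (size N') xs) \<le> sum_mset N'"
      using Cons.prems y(2) by (intro Cons.IH) (auto simp: N'_def)
    ultimately show ?thesis by (simp add: N add_mono)
  qed simp
qed simp

lemma sum_sorted_le_sum_inj_on:
  fixes f :: "'b \<Rightarrow> real" and e :: "nat \<Rightarrow> 'b"
  assumes "finite A" and "inj_on e {1..q}" and "e ` {1..q} \<subseteq> A"
  shows "(\<Sum>p = 1..q. sorted_list_of_multiset (image_mset f (mset_set A)) ! (p - 1))
    \<le> (\<Sum>p = 1..q. f (e p))"
proof -
  define xs where "xs = sorted_list_of_multiset (image_mset f (mset_set A))"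
  define N where "N = image_mset f (mset_set (e ` {1..q}))"
  have "N \<subseteq># mset xs"
    unfolding N_def xs_def
    using assms by (simp add: image_mset_subseteq_mono subset_imp_msubset_mset_set)
  then have le: "sum_list (take (size N) xs) \<le> sum_mset N" and "size N \<le> length xs"
    using sum_list_take_sorted_le_sum_mset[of xs N] size_mset_mono[of N "mset xs"]
    by (auto simp: xs_def simp flip: size_mset)
  have size: "size N = q" using assms(2) by (simp add: N_def card_image)
  have "(\<Sum>p = 1..q. xs ! (p - 1)) = (\<Sum>p<q. xs ! p)"
    by (rule sum.reindex_bij_witness[of _ Suc "\<lambda>p. p - 1"]) auto
  also have "\<dots> = sum_list (take q xs)"
    using \<open>size N \<le> length xs\<close> size by (simp add: sum_list_sum_nth atLeast0LessThan)
  also have "\<dots> \<le> sum_mset N" using le size by simp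
  also have "\<dots> = (\<Sum>p = 1..q. f (e p))"
    using assms(2) by (simp add: N_def sum_unfold_sum_mset[symmetric] sum.reindex)
  finally show ?thesis by (simp add: xs_def)
qed

section \<open>Positions and legs of a Hamiltonian cycle\<close>

lemma length_hamiltonian_cycle:
  assumes "hamiltonian_cycle n H"
  shows "length H = n + 2"
proof -
  have "length (tl H) = card (set (tl H))"
    using assms unfolding hamiltonian_cycle_def by (metis distinct_card)
  also have "\<dots> = n + 1"
    using assms by (simp add: hamiltonian_cycle_def road_network_def)
  finally show ?thesis by simp
qed

lemma hamiltonian_cycle_bij_betw:
  assumes "hamiltonian_cycle n H"
  shows "bij_betw ((!) H) {1..n} {1..n}"
proof -
  note len = length_hamiltonian_cycle[OF assms]
  have nth: "H ! p = tl H ! (p - 1)" if "p \<in> {1..Suc n}" for p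
    using that len by (cases p) (auto simp: nth_tl)
  have inj: "inj_on ((!) H) {1..Suc n}"
  proof (rule inj_onI)
    fix p q assume "p \<in> {1..Suc n}" "q \<in> {1..Suc n}" "H ! p = H ! q"
    moreover from this have "p - 1 = q - 1"
      using assms len nth nth_eq_iff_index_eq[of "tl H" "p - 1" "q - 1"]
      by (auto simp: hamiltonian_cycle_def)
    ultimately show "p = q" by auto
  qed
  have last: "H ! Suc n = 0"
    using assms len by (metis add_2_eq_Suc' diff_Suc_1 hamiltonian_cycle_def last_conv_nth
        list.size(3) nat.simps(3))
  have "H ! p \<in> {1..n}" if p: "p \<in> {1..n}" for p
  proof -
    have p': "p \<in> {1..Suc n}" using p by simp
    have "H ! p \<in> set (tl H)" using p len unfolding nth[OF p'] by (intro nth_mem) auto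
    moreover have "H ! p \<noteq> 0"
      using inj_onD[OF inj, of p "Suc n"] p last by auto
    ultimately show ?thesis using assms by (auto simp: hamiltonian_cycle_def road_network_def)
  qed
  moreover have "inj_on ((!) H) {1..n}" using inj by (rule inj_on_subset) auto
  ultimately show ?thesis
    unfolding bij_betw_def using endo_inj_surj[of "{1..n}" "(!) H"] by blast
qed

text \<open>
  A customer vertex is never the depot, so position \<open>0\<close> is ruled out, and among the positions
  \<open>1, \<dots>, n\<close> the cycle is injective.
\<close>
lemma visits_at_nth_iff:
  assumes "hamiltonian_cycle n H" and "p \<in> {1..n}"
  shows "visits_at H (H ! p) q \<longleftrightarrow> q = p"
proof -
  note len = length_hamiltonian_cycle[OF assms(1)]
  note bij = hamiltonian_cycle_bij_betw[OF assms(1)]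
  have "H ! 0 = 0" using assms(1) len
    by (metis add_2_eq_Suc' hamiltonian_cycle_def hd_conv_nth list.size(3) nat.simps(3))
  moreover have "H ! p \<in> {1..n}" using bij assms(2) by (rule bij_betwE[rule_format])
  ultimately have "q \<in> {1..n}" if "visits_at H (H ! p) q"
    using that len by (cases "q = 0") (auto simp: visits_at_def)
  then show ?thesis
    using assms(2) len inj_onD[OF bij_betw_imp_inj_on[OF bij], of q p]
    by (auto simp: visits_at_def)
qed

lemma position_nth:
  assumes "hamiltonian_cycle n H" and "p \<in> {1..n}"
  shows "position H (H ! p) = p"
  unfolding position_def by (rule the_equality) (simp_all add: visits_at_nth_iff[OF assms])

lemma position_eqI:
  assumes "hamiltonian_cycle n H" and "i \<in> {1..n}" and "visits_at H i p"
  shows "position H i = p"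
proof -
  obtain q where q: "q \<in> {1..n}" "H ! q = i"
    using hamiltonian_cycle_bij_betw[OF assms(1)] assms(2)
    by (metis bij_betw_imp_surj_on imageE)
  then show ?thesis
    using visits_at_nth_iff[OF assms(1) q(1), of p] position_nth[OF assms(1) q(1)] assms(3) by simp
qed

lemma position_in_range:
  assumes "hamiltonian_cycle n H" and "j \<in> {1..n}"
  shows "position H j \<in> {1..n}"
proof -
  obtain q where "q \<in> {1..n}" "H ! q = j"
    using hamiltonian_cycle_bij_betw[OF assms(1)] assms(2)
    by (metis bij_betw_imp_surj_on imageE)
  then show ?thesis using position_nth[OF assms(1)] by force
qed

lemma card_position_ge:
  assumes "hamiltonian_cycle n H" and "q \<in> {1..n}"
  shows "card {j \<in> {1..n}. q \<le> position H j} = n - q + 1"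
proof -
  note bij = hamiltonian_cycle_bij_betw[OF assms(1)]
  have "{j \<in> {1..n}. q \<le> position H j} = (!) H ` {q..n}"
  proof (intro set_eqI iffI)
    fix j assume j: "j \<in> {j \<in> {1..n}. q \<le> position H j}"
    then obtain p where "p \<in> {1..n}" "j = H ! p"
      using bij by (metis (no_types, lifting) bij_betw_imp_surj_on imageE mem_Collect_eq)
    then show "j \<in> (!) H ` {q..n}" using j position_nth[OF assms(1)] by auto
  next
    fix j assume "j \<in> (!) H ` {q..n}"
    then obtain p where "p \<in> {q..n}" "j = H ! p" by blast
    then show "j \<in> {j \<in> {1..n}. q \<le> position H j}"
      using position_nth[OF assms(1), of p] bij_betwE[OF bij] assms(2) by auto
  qed
  moreover have "inj_on ((!) H) {q..n}"
    using bij_betw_imp_inj_on[OF bij] assms(2) by (auto intro: inj_on_subset)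
  ultimately show ?thesis using assms(2) by (simp add: card_image Suc_diff_le)
qed

lemma leg_in_arcs:
  assumes "hamiltonian_cycle n H" and "q \<in> {1..n}"
  shows "(H ! (q - 1), H ! q) \<in> parcs (road_network n)"
proof -
  have "Suc (q - 1) < length H \<and> q = Suc (q - 1)"
    using assms length_hamiltonian_cycle[OF assms(1)] by auto
  then have "(H ! (q - 1), H ! q) \<in> set (vwalk_arcs H)"
    unfolding vwalk_arcs_nth by force
  then show ?thesis using assms(1) by (auto simp: hamiltonian_cycle_def vwalk_def)
qed

text \<open>Distinct legs end at distinct customers, so they are distinct arcs.\<close>
lemma sum_shortest_arcs_le_sum_legs:
  assumes "hamiltonian_cycle n H" and "q \<le> n"
  shows "(\<Sum>p = 1..q. shortest_arc_length n d p) \<le> (\<Sum>p = 1..q. d (H ! (p - 1)) (H ! p))"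
proof -
  let ?e = "\<lambda>p. (H ! (p - 1), H ! p)"
  have "inj_on ((!) H) {1..q}"
    using bij_betw_imp_inj_on[OF hamiltonian_cycle_bij_betw[OF assms(1)]] assms(2)
    by (auto intro: inj_on_subset)
  then have "inj_on (snd \<circ> ?e) {1..q}" by (simp add: comp_def)
  then have "inj_on ?e {1..q}" by (rule inj_on_imageI2)
  moreover have "?e ` {1..q} \<subseteq> parcs (road_network n)"
    using leg_in_arcs[OF assms(1)] assms(2) by auto
  moreover have "finite (parcs (road_network n))"
    by (rule finite_subset[of _ "{0..n} \<times> {0..n}"]) (auto simp: road_network_def)
  ultimately show ?thesis
    using sum_sorted_le_sum_inj_on[of "parcs (road_network n)" ?e q "\<lambda>(i, j). d i j"]
    by (simp add: shortest_arc_length_def)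
qed

section \<open>Disruption caused by each leg\<close>

text \<open>
  The coefficient of \<open>s\<^sub>q\<close> in \<open>L\<^sub>i\<^sup>k\<close> where \<open>m = |S\<^sub>i|\<close>.
\<close>
definition leg_weight :: "nat \<Rightarrow> nat \<Rightarrow> nat \<Rightarrow> nat \<Rightarrow> nat" where
  "leg_weight n m k q = (if q \<le> n - m \<or> k + 1 \<le> q then n - q + 1 else m)"

lemma position_bound_eq_weighted_sum:
  assumes "k \<le> n" and "m = card (power_successors T i)"
  shows "position_bound n d T i k =
    (\<Sum>q = 1..n. real (leg_weight n m k q) * shortest_arc_length n d q)"
proof -
  let ?w = "\<lambda>q. real (leg_weight n m k q) * shortest_arc_length n d q"
  let ?A = "{q \<in> {1..n}. q \<le> n - m \<or> k + 1 \<le> q}" and ?B = "{n - m + 1..k}"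
  have "{1..n} = ?A \<union> ?B" using assms(1) by auto
  then have "sum ?w {1..n} = sum ?w (?A \<union> ?B)" by (rule arg_cong)
  also have "\<dots> = sum ?w ?A + sum ?w ?B"
    by (rule sum.union_disjoint) auto
  also have "sum ?w ?A = (\<Sum>q \<in> ?A. real (n - q + 1) * shortest_arc_length n d q)"
    by (rule sum.cong) (auto simp: leg_weight_def)
  also have "sum ?w ?B = real m * (\<Sum>q \<in> ?B. shortest_arc_length n d q)"
    unfolding sum_distrib_left by (rule sum.cong) (auto simp: leg_weight_def)
  finally show ?thesis by (simp add: position_bound_def assms(2) Let_def)
qed

text \<open>
  After leg \<open>k\<close> the weight passes from \<open>m\<close> to \<open>n - k\<close>; this is a decrease because \<open>k > n - m\<close>.
\<close>
lemma leg_weight_antimono: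
  assumes "k > n - m" and "m \<le> n" and "q < n"
  shows "leg_weight n m k (Suc q) \<le> leg_weight n m k q"
  using assms by (auto simp: leg_weight_def)

lemma arrival_time_le_disruption_time:
  assumes "finite (pverts T)" and "i \<in> pverts T" and "i \<rightarrow>\<^sup>*\<^bsub>with_proj T\<^esub> j"
  shows "arrival_time d H i \<le> disruption_time d T H j"
  unfolding disruption_time_def using assms by (intro Max_ge) auto

text \<open>
  If \<open>f j\<close> is the last leg that is certain to precede the restoration of customer \<open>j\<close>, the total
  disruption is bounded below by counting, for each leg \<open>q\<close>, the customers with \<open>q \<le> f j\<close>.
\<close>
lemma weighted_legs_le_total_disruption:
  assumes inst: "prtrp_instance n d T" and hc: "hamiltonian_cycle n H"
    and i: "i \<in> {1..n}" and k: "k \<le> position H i"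
    and m: "m = card (power_successors T i)"
  shows "(\<Sum>q = 1..n. real (leg_weight n m k q) * d (H ! (q - 1)) (H ! q))
    \<le> total_disruption d T H"
proof -
  define a where "a q = d (H ! (q - 1)) (H ! q)" for q
  define f where
    "f j = (if j \<in> power_successors T i then max (position H j) k else position H j)" for j
  have V: "pverts T = {1..n}" using inst by (simp add: prtrp_instance_def)
  have wf: "wf_digraph (with_proj T)"
    using inst by (simp add: prtrp_instance_def rooted_directed_tree_def)
  have S: "power_successors T i \<subseteq> {1..n}" by (auto simp: power_successors_def V)
  have a_nonneg: "0 \<le> a q" if "q \<in> {1..n}" for q
    using leg_in_arcs[OF hc that] inst by (auto simp: a_def prtrp_instance_def)
  have kn: "k \<le> n" using k position_in_range[OF hc i] by simp
  have arrival: "arrival_time d H j = (\<Sum>q = 1..position H j. a q)" for j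
    by (simp add: arrival_time_def a_def)
  have weight: "leg_weight n m k q \<le> card {j \<in> {1..n}. q \<le> f j}" if q: "q \<in> {1..n}" for q
  proof -
    have "n - q + 1 \<le> card {j \<in> {1..n}. q \<le> f j}"
      unfolding card_position_ge[OF hc q, symmetric] by (rule card_mono) (auto simp: f_def)
    moreover have "m \<le> card {j \<in> {1..n}. q \<le> f j}" if "q \<le> k"
      unfolding m using S that by (intro card_mono) (auto simp: f_def)
    ultimately show ?thesis by (auto simp: leg_weight_def)
  qed
  have restore: "(\<Sum>q = 1..f j. a q) \<le> disruption_time d T H j" if j: "j \<in> {1..n}" for j
  proof -
    have "j \<rightarrow>\<^sup>*\<^bsub>with_proj T\<^esub> j" using j
      by (intro wf_digraph.reachable_refl[OF wf]) (simp add: V)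
    then have self: "(\<Sum>q = 1..position H j. a q) \<le> disruption_time d T H j"
      using arrival_time_le_disruption_time[of T j j d H] j by (simp add: V arrival)
    have "(\<Sum>q = 1..k. a q) \<le> disruption_time d T H j" if "j \<in> power_successors T i"
    proof -
      have "(\<Sum>q = 1..k. a q) \<le> (\<Sum>q = 1..position H i. a q)"
        using k position_in_range[OF hc i] a_nonneg by (intro sum_mono2) auto
      also have "\<dots> \<le> disruption_time d T H j"
        using arrival_time_le_disruption_time[of T i j d H] i that
        by (simp add: V arrival power_successors_def)
      finally show ?thesis .
    qed
    then show ?thesis using self by (auto simp: f_def max_def)
  qed
  have "(\<Sum>q = 1..n. real (leg_weight n m k q) * a q)
      \<le> (\<Sum>q = 1..n. real (card {j \<in> {1..n}. q \<le> f j}) * a q)"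
    using weight a_nonneg by (intro sum_mono mult_right_mono) auto
  also have "\<dots> = (\<Sum>q = 1..n. \<Sum>j = 1..n. if q \<le> f j then a q else 0)"
    by (simp add: sum.inter_filter[symmetric])
  also have "\<dots> = (\<Sum>j = 1..n. \<Sum>q = 1..n. if q \<le> f j then a q else 0)"
    by (rule sum.swap)
  also have "\<dots> = (\<Sum>j = 1..n. \<Sum>q = 1..f j. a q)"
  proof (rule sum.cong[OF refl])
    fix j assume "j \<in> {1..n}"
    then have "f j \<le> n" using position_in_range[OF hc, of j] kn by (auto simp: f_def)
    then have "{q \<in> {1..n}. q \<le> f j} = {1..f j}" by auto
    then show "(\<Sum>q = 1..n. if q \<le> f j then a q else 0) = (\<Sum>q = 1..f j. a q)"
      by (simp add: sum.inter_filter[symmetric])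
  qed
  also have "\<dots> \<le> total_disruption d T H"
    unfolding total_disruption_def V by (rule sum_mono) (rule restore)
  finally show ?thesis by (simp add: a_def)
qed

section \<open>The position bound\<close>

lemma position_bound_le_total_disruption:
  assumes inst: "prtrp_instance n d T" and hc: "hamiltonian_cycle n H"
    and i: "i \<in> {1..n}" and k: "k \<le> position H i"
    and late: "k > n - card (power_successors T i)"
  shows "position_bound n d T i k \<le> total_disruption d T H"
proof -
  define m where "m = card (power_successors T i)"
  have "power_successors T i \<subseteq> {1..n}"
    using inst by (auto simp: power_successors_def prtrp_instance_def)
  then have mn: "m \<le> n" unfolding m_def using card_mono[of "{1..n}"] by fastforce
  have "k \<le> n" using k position_in_range[OF hc i] by simp
  then have "position_bound n d T i k =
      (\<Sum>q = 1..n. real (leg_weight n m k q) * shortest_arc_length n d q)"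
    by (rule position_bound_eq_weighted_sum) (rule m_def)
  also have "\<dots> \<le> (\<Sum>q = 1..n. real (leg_weight n m k q) * d (H ! (q - 1)) (H ! q))"
    using leg_weight_antimono late mn
    by (intro weighted_sum_mono_of_partial_sums sum_shortest_arcs_le_sum_legs[OF hc])
      (auto simp: m_def)
  also have "\<dots> \<le> total_disruption d T H"
    using weighted_legs_le_total_disruption[OF inst hc i k m_def] .
  finally show ?thesis .
qed

lemma total_disruption_optimal_cycle:
  assumes "optimal_cycle n d T H"
  shows "total_disruption d T H = optimal_value n d T"
  unfolding optimal_value_def
  using assms finite_hamiltonian_cycles
  by (intro Min_eqI[symmetric]) (auto simp: optimal_cycle_def is_arg_min_linorder)

theorem proposition5:
  fixes n :: nat and d :: "nat \<Rightarrow> nat \<Rightarrow> real" and T :: "nat pair_pre_digraph"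
    and U :: real and i k :: nat
  assumes "prtrp_instance n d T"
    and "optimal_value n d T \<le> U"
    and "i \<in> {1..n}"
    and "k \<in> {1..n}"
    and "k > n - card (power_successors T i)"
    and "position_bound n d T i k > U"
  shows "\<forall>H. optimal_cycle n d T H \<longrightarrow> \<not> (\<exists>k' \<ge> k. visits_at H i k')"
proof (intro allI impI notI)
  fix H assume opt: "optimal_cycle n d T H" and "\<exists>k' \<ge> k. visits_at H i k'"
  then obtain k' where "k \<le> k'" "visits_at H i k'" by blast
  moreover have hc: "hamiltonian_cycle n H"
    using opt by (simp add: optimal_cycle_def is_arg_min_def)
  ultimately have "k \<le> position H i" using position_eqI[OF hc assms(3)] by simp
  then have "position_bound n d T i k \<le> total_disruption d T H"
    using position_bound_le_total_disruption[OF assms(1) hc assms(3)] assms(5) by blast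
  then show False using total_disruption_optimal_cycle[OF opt] assms(2,6) by simp
qed

end
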